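(* For every finite word $w\in\{L,R\}^\star$ and every $d\in\mathbb{Z}$, $$P_w(d)=P_{\overline{w}}(-d)\quad\text{and}\quad P_w(d)=P_{\overleftarrow{w}}(d).$$
   Context: $\{L,R\}^\star$ is the set of all finite words in the letters $L,R$, including the empty word $\varepsilon$. For a word $w=w_1\dots w_n$, $\overline{w}$ is the word obtained by interchanging the letters $L$ and $R$, and $\overleftarrow{w}=w_n\dots w_1$ is the reversed word ($\overleftarrow{\varepsilon}=\varepsilon$). For probability measures $\mu,\nu$ on $\mathbb{Z}$ with mean zero, $\Phi(\mu,\nu)(d)=\frac12\mu(d+1)+\frac12\nu(d-1)$, $\Phi_L(\mu,\nu)=(\Phi(\mu,\nu),\nu)$, $\Phi_R(\mu,\nu)=(\mu,\Phi(\mu,\nu))$. For a word $w=w_1\dots w_n$ put $P_w=\Phi\circ\Phi_{w_n}\circ\cdots\circ\Phi_{w_1}(\delta_0,\delta_0)$, with $P_\varepsilon=\Phi(\delta_0,\delta_0)=\frac12\delta_{-1}+\frac12\delta_1$. *)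

theory Defs
  imports "HOL-Probability.Probability"
begin

datatype letter = L | R

primrec swap_letter :: "letter \<Rightarrow> letter" where
  "swap_letter L = R"
| "swap_letter R = L"

definition swap_word :: "letter list \<Rightarrow> letter list" where
  "swap_word w = map swap_letter w"

definition mean_zero :: "int pmf \<Rightarrow> bool" where
  "mean_zero p \<longleftrightarrow>
     integrable (measure_pmf p) real_of_int \<and> measure_pmf.expectation p real_of_int = 0"

text \<open>
  The operation is defined on all probability measures on the integers. The lemma \<open>pmf_Phi\<close>
  below shows that the function given to \<^const>\<open>embed_pmf\<close> is a probability mass function, and
  \<open>mean_zero_Phi\<close> that the operation restricts to the measures of mean zero.
\<close>

definition Phi :: "int pmf \<Rightarrow> int pmf \<Rightarrow> int pmf" where
  "Phi \<mu> \<nu> = embed_pmf (\<lambda>d. 1/2 * pmf \<mu> (d + 1) + 1/2 * pmf \<nu> (d - 1))"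

fun Phi_letter :: "letter \<Rightarrow> int pmf \<times> int pmf \<Rightarrow> int pmf \<times> int pmf" where
  "Phi_letter L (\<mu>, \<nu>) = (Phi \<mu> \<nu>, \<nu>)"
| "Phi_letter R (\<mu>, \<nu>) = (\<mu>, Phi \<mu> \<nu>)"

text \<open>\<^const>\<open>fold\<close> applies the map of the first letter of the word first.\<close>

definition P :: "letter list \<Rightarrow> int pmf" where
  "P w = case_prod Phi (fold Phi_letter w (return_pmf 0, return_pmf 0))"

lemma pmf_Phi: "pmf (Phi \<mu> \<nu>) d = 1/2 * pmf \<mu> (d + 1) + 1/2 * pmf \<nu> (d - 1)"
proof -
  have shift: "(\<integral>\<^sup>+x. ennreal (pmf p (x + c)) \<partial>count_space UNIV) = 1" for p :: "int pmf" and c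
  proof -
    have "bij_betw (\<lambda>x. x + c) UNIV UNIV"
      by (rule bij_betwI[where g = "\<lambda>x. x - c"]) auto
    from nn_integral_bij_count_space[OF this, of "\<lambda>x. ennreal (pmf p x)"]
    show ?thesis by (simp add: nn_integral_pmf)
  qed
  have "(\<integral>\<^sup>+x. ennreal (1/2 * pmf \<mu> (x + 1) + 1/2 * pmf \<nu> (x - 1)) \<partial>count_space UNIV)
      = (\<integral>\<^sup>+x. ennreal (1/2) * ennreal (pmf \<mu> (x + 1)) + ennreal (1/2) * ennreal (pmf \<nu> (x + - 1))
           \<partial>count_space UNIV)"
    by (intro nn_integral_cong) (simp add: ennreal_mult[symmetric] ennreal_plus[symmetric] del: ennreal_plus ennreal_half)
  also have "\<dots> = ennreal (1/2) + ennreal (1/2)"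
    by (subst nn_integral_add) (simp_all add: nn_integral_cmult shift del: add_uminus_conv_diff)
  also have "\<dots> = 1"
    by (subst ennreal_plus[symmetric]) auto
  finally show ?thesis
    unfolding Phi_def by (intro pmf_embed_pmf) auto
qed

lemma mean_zero_iff_count_space:
  "mean_zero p \<longleftrightarrow>
     has_bochner_integral (count_space UNIV) (\<lambda>x. pmf p x * real_of_int x) 0"
  unfolding mean_zero_def has_bochner_integral_iff measure_pmf_eq_density
  by (simp add: integrable_real_density integral_real_density)

lemma mean_zero_Phi:
  assumes "mean_zero \<mu>" "mean_zero \<nu>"
  shows "mean_zero (Phi \<mu> \<nu>)"
proof -
  have shifted: "has_bochner_integral (count_space UNIV)
      (\<lambda>x. pmf p (x + c) * real_of_int x) (- real_of_int c)"
    if p: "mean_zero p" for p :: "int pmf" and c :: int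
  proof -
    have 1: "has_bochner_integral (count_space UNIV) (\<lambda>x. pmf p x) 1"
      using integrable_pmf[of UNIV p] integral_pmf[of UNIV p]
      by (simp add: has_bochner_integral_iff)
    have "has_bochner_integral (count_space UNIV)
        (\<lambda>x. pmf p x * real_of_int x - pmf p x * real_of_int c) (0 - 1 * real_of_int c)"
      using p 1
      by (intro has_bochner_integral_diff has_bochner_integral_mult_left)
        (auto simp: mean_zero_iff_count_space)
    then have *: "has_bochner_integral (count_space UNIV)
        (\<lambda>x. pmf p x * real_of_int (x - c)) (- real_of_int c)"
      by (simp add: algebra_simps)
    have "bij_betw (\<lambda>x. x + c) UNIV UNIV"
      by (rule bij_betwI[where g = "\<lambda>x. x - c"]) auto
    from integrable_bij_count_space[OF this, of "\<lambda>x. pmf p x * real_of_int (x - c)"]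
      integral_bij_count_space[OF this, of "\<lambda>x. pmf p x * real_of_int (x - c)"] *
    show ?thesis by (simp add: has_bochner_integral_iff)
  qed
  have "has_bochner_integral (count_space UNIV)
      (\<lambda>x. 1/2 * (pmf \<mu> (x + 1) * real_of_int x) + 1/2 * (pmf \<nu> (x + - 1) * real_of_int x))
      (1/2 * (- real_of_int 1) + 1/2 * (- real_of_int (- 1)))"
    by (intro has_bochner_integral_add has_bochner_integral_mult_right shifted assms)
  then show ?thesis
    unfolding mean_zero_iff_count_space pmf_Phi by (simp add: algebra_simps)
qed

lemma mean_zero_P: "mean_zero (P w)"
proof -
  have *: "mean_zero (fst (fold Phi_letter w m)) \<and> mean_zero (snd (fold Phi_letter w m))"
    if "mean_zero (fst m)" "mean_zero (snd m)" for m
    using that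
  proof (induction w arbitrary: m)
    case (Cons a w)
    then show ?case by (cases a; cases m) (auto simp: mean_zero_Phi)
  qed simp
  have "mean_zero (return_pmf 0)"
    by (simp add: mean_zero_def integrable_measure_pmf_finite)
  with *[of "(return_pmf 0, return_pmf 0)"] show ?thesis
    by (auto simp: P_def case_prod_beta intro: mean_zero_Phi)
qed

lemma P_Nil: "pmf (P []) d = (if d = -1 \<or> d = 1 then 1/2 else 0)"
  by (auto simp: P_def pmf_Phi indicator_def)

end

theory Submission
  imports Defs "HOL-Computational_Algebra.Formal_Laurent_Series"
begin

text \<open>
  The reflection symmetry holds because \<open>\<Phi>\<close> commutes with \<open>d \<mapsto> -d\<close> up to exchanging its arguments.

  For the reversal symmetry, pass to generating functions. With \<open>a = X\<^sup>-\<^sup>1 / 2\<close> and \<open>b = X / 2\<close>, the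
  letters act linearly on pairs, by \<open>(x, y) \<mapsto> (a x + b y, y)\<close> and \<open>(x, y) \<mapsto> (x, a x + b y)\<close>, and both
  maps are self-adjoint for the symmetric bilinear form with matrix
  \<open>((a (a - 1), a b), (a b, b (b - 1)))\<close>. Pairing with \<open>(1, 1)\<close> in this form is \<open>a + b - 1\<close>
  times the functional \<open>(x, y) \<mapsto> a x + b y\<close>, which computes \<open>P\<^sub>w\<close> from the pair reached after reading
  \<open>w\<close>. Moving the letters across the form reverses the word, and the factor \<open>a + b - 1\<close> cancels.
\<close>

fun letter_map :: "'a::comm_ring_1 \<Rightarrow> 'a \<Rightarrow> letter \<Rightarrow> 'a \<times> 'a \<Rightarrow> 'a \<times> 'a" where
  "letter_map a b L (x, y) = (a * x + b * y, y)"
| "letter_map a b R (x, y) = (x, a * x + b * y)"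

fun letter_form :: "'a::comm_ring_1 \<Rightarrow> 'a \<Rightarrow> 'a \<times> 'a \<Rightarrow> 'a \<times> 'a \<Rightarrow> 'a" where
  "letter_form a b (x, y) (x', y') =
     a * (a - 1) * x * x' + a * b * (x * y' + y * x') + b * (b - 1) * y * y'"

lemma letter_form_commute: "letter_form a b s t = letter_form a b t s"
  by (cases s; cases t) (simp add: algebra_simps)

lemma letter_form_letter_map:
  "letter_form a b (letter_map a b l s) t = letter_form a b s (letter_map a b l t)"
  by (cases l; cases s; cases t) (simp_all add: algebra_simps)

lemma letter_form_fold:
  "letter_form a b (fold (letter_map a b) w s) t
     = letter_form a b s (fold (letter_map a b) (rev w) t)"
  by (induction w arbitrary: s) (simp_all add: letter_form_letter_map)

lemma letter_form_one:
  "letter_form a b (1, 1) s = (a + b - 1) * (a * fst s + b * snd s)"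
  by (cases s) (simp add: algebra_simps)

lemma fold_letter_map_rev:
  fixes a b :: "'a::idom"
  assumes "a + b \<noteq> 1"
  defines "G \<equiv> \<lambda>w. fold (letter_map a b) w (1, 1)"
  shows "a * fst (G w) + b * snd (G w) = a * fst (G (rev w)) + b * snd (G (rev w))"
proof -
  \<comment> \<open>Symmetry brings \<open>G w\<close> into the first slot; moving its letters
    across leaves \<open>(1, 1)\<close> there.\<close>
  have "letter_form a b (1, 1) (G w) = letter_form a b (1, 1) (G (rev w))"
    unfolding G_def by (metis letter_form_fold letter_form_commute)
  with assms(1) show ?thesis
    by (simp add: letter_form_one)
qed

text \<open>Laurent series allow negative exponents and form an integral domain, as the cancellation
  requires.\<close>

abbreviation down :: "real fls" where
  "down \<equiv> fls_const (1/2) * fls_X_inv"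

abbreviation up :: "real fls" where
  "up \<equiv> fls_const (1/2) * fls_X"

lemma fls_nth_down_up:
  "fls_nth (down * F + up * G) d = 1/2 * fls_nth F (d + 1) + 1/2 * fls_nth G (d - 1)"
  by (simp add: fls_X_inv_times_conv_shift fls_X_times_conv_shift fls_shifted_times_simps)

lemma down_up_neq_one: "down + up \<noteq> 1"
proof
  assume "down + up = 1"
  \<comment> \<open>Only the exponents -1 and 1 occur in \<open>down + up\<close>, so its constant
    coefficient is 0.\<close>
  then have "fls_nth (down * 1 + up * 1) 0 = fls_nth 1 0" by simp
  then show False unfolding fls_nth_down_up by simp
qed

lemma fls_nth_fold_letter_map:
  assumes "fls_nth (fst s) = pmf (fst m)" "fls_nth (snd s) = pmf (snd m)"
  shows "fls_nth (fst (fold (letter_map down up) w s)) = pmf (fst (fold Phi_letter w m)) \<and>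
         fls_nth (snd (fold (letter_map down up) w s)) = pmf (snd (fold Phi_letter w m))"
  using assms
proof (induction w arbitrary: s m)
  case (Cons l w)
  have "fls_nth (fst (letter_map down up l s)) = pmf (fst (Phi_letter l m))"
    "fls_nth (snd (letter_map down up l s)) = pmf (snd (Phi_letter l m))"
    using Cons.prems
    by (cases l; cases s; cases m; auto simp: fun_eq_iff pmf_Phi fls_nth_down_up simp del: fls_plus_nth)+
  from Cons.IH[OF this] show ?case by simp
qed simp

lemma pmf_P_eq_fls_nth:
  defines "G \<equiv> \<lambda>w. fold (letter_map down up) w (1, 1)"
  shows "pmf (P w) d = fls_nth (down * fst (G w) + up * snd (G w)) d"
proof -
  have "fls_nth (1 :: real fls) = pmf (return_pmf 0)"
    by (auto simp: fun_eq_iff indicator_def)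
  then show ?thesis
    using fls_nth_fold_letter_map[of "(1, 1)" "(return_pmf 0, return_pmf 0)" w]
    unfolding G_def fls_nth_down_up P_def by (simp add: case_prod_beta pmf_Phi)
qed

lemma pmf_P_rev: "pmf (P (rev w)) d = pmf (P w) d"
  by (simp only: pmf_P_eq_fls_nth fold_letter_map_rev[OF down_up_neq_one, of w])

text \<open>Swapping letters exchanges the roles of the two components, so \<open>fst\<close> is
  matched with the reflected \<open>snd\<close>.\<close>

lemma pmf_fold_swap_word:
  assumes "\<And>d. pmf (fst m') d = pmf (snd m) (- d)" "\<And>d. pmf (snd m') d = pmf (fst m) (- d)"
  shows "pmf (fst (fold Phi_letter (swap_word w) m')) d = pmf (snd (fold Phi_letter w m)) (- d) \<and>
         pmf (snd (fold Phi_letter (swap_word w) m')) d = pmf (fst (fold Phi_letter w m)) (- d)"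
  using assms
proof (induction w arbitrary: m m')
  case (Cons l w)
  have "pmf (fst (Phi_letter (swap_letter l) m')) d = pmf (snd (Phi_letter l m)) (- d)"
    "pmf (snd (Phi_letter (swap_letter l) m')) d = pmf (fst (Phi_letter l m)) (- d)" for d
    using Cons.prems by (cases l; cases m; cases m'; simp add: pmf_Phi)+
  from Cons.IH[OF this] show ?case by (simp add: swap_word_def)
qed (simp add: swap_word_def)

lemma pmf_P_swap_word: "pmf (P (swap_word w)) d = pmf (P w) (- d)"
proof -
  let ?m = "(return_pmf 0, return_pmf 0) :: int pmf \<times> int pmf"
  have "pmf (fst (fold Phi_letter (swap_word w) ?m)) e = pmf (snd (fold Phi_letter w ?m)) (- e) \<and>
        pmf (snd (fold Phi_letter (swap_word w) ?m)) e = pmf (fst (fold Phi_letter w ?m)) (- e)" for e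
    by (rule pmf_fold_swap_word) (auto simp: indicator_def)
  then show ?thesis
    by (simp add: P_def case_prod_beta pmf_Phi)
qed

theorem theorem17:
  fixes w :: "letter list" and d :: int
  shows "pmf (P w) d = pmf (P (swap_word w)) (- d) \<and> pmf (P w) d = pmf (P (rev w)) d"
  by (simp add: pmf_P_swap_word pmf_P_rev)

end
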